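(* Let $m\le n$, let $f:\mathbb{R}^{m\times n}\to\mathbb{R}_+$ be a smooth function, let $\nu,\mu>0$, and let $\kappa\ge1$ be an integer. Let $\mathcal{X}^*$ be the (nonempty) set of global optimal solutions of $\min_{X\in\mathbb{R}^{m\times n}}\{\nu f(X)+{\rm rank}(X)\}$ and suppose $\mathcal{X}^*\cap\Omega_\kappa\ne\emptyset$. Then the set of global optimal solutions of $$\min_{U\in\mathbb{R}^{m\times\kappa},V\in\mathbb{R}^{n\times\kappa}}\Big\{\nu f(UV^{\mathbb{T}})+\frac\mu4\|U^{\mathbb{T}}U-V^{\mathbb{T}}V\|_F^2+\frac12\big(\|U\|_{2,0}+\|V\|_{2,0}\big)\Big\}$$ is $$\mathcal{W}^*=\Big\{(\overline{U},\overline{V}):\ \overline{U}\,\overline{V}^{\mathbb{T}}\in\mathcal{X}^*\cap\Omega_\kappa,\ \overline{U}^{\mathbb{T}}\overline{U}=\overline{V}^{\mathbb{T}}\overline{V},\ \|\overline{U}\|_{2,0}=\|\overline{V}\|_{2,0}={\rm rank}(\overline{U}\,\overline{V}^{\mathbb{T}})\Big\},$$ where $(\overline{U},\overline{V})$ ranges over $\mathbb{R}^{m\times\kappa}\times\mathbb{R}^{n\times\kappa}$.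
   Context: $\|\cdot\|_F$ is the Frobenius norm, $\|U\|_{2,0}$ is the number of nonzero columns of $U$, and $\Omega_\kappa:=\{X\in\mathbb{R}^{m\times n}:{\rm rank}(X)\le\kappa\}$. *)

theory Defs
  imports "HOL-Analysis.Analysis"
begin

text \<open>
  An element of \<open>real ^ 'n ^ 'm\<close> is a matrix with \<open>CARD('m)\<close> rows and \<open>CARD('n)\<close> columns, and
  \<open>norm\<close> on this type is the Frobenius norm:
\<close>

lemma norm_eq_frobenius:
  fixes A :: "real ^ 'n ^ 'm"
  shows "norm A = sqrt (\<Sum>i\<in>UNIV. \<Sum>j\<in>UNIV. (A $ i $ j)\<^sup>2)"
  by (simp add: norm_vec_def L2_set_def sum_nonneg)

definition norm_2_0 :: "real ^ 'n ^ 'm \<Rightarrow> nat"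
  where "norm_2_0 A = card {j. column j A \<noteq> 0}"

definition Omega :: "nat \<Rightarrow> (real ^ 'n ^ 'm) set"
  where "Omega k = {X. rank X \<le> k}"

text \<open>
  Smooth in the sense of optimization, i.e. continuously differentiable.  Being weaker than
  infinite differentiability, this also covers the latter reading.
\<close>

definition smooth :: "('a::real_normed_vector \<Rightarrow> real) \<Rightarrow> bool"
  where "smooth f \<longleftrightarrow> (\<exists>f' :: 'a \<Rightarrow> 'a \<Rightarrow>\<^sub>L real.
    (\<forall>x. (f has_derivative blinfun_apply (f' x)) (at x)) \<and> continuous_on UNIV f')"

definition global_minimizers :: "('a \<Rightarrow> real) \<Rightarrow> 'a set"
  where "global_minimizers F = {x. is_arg_min F (\<lambda>_. True) x}"

end

theory Submission
  imports Defs
begin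

text \<open>
  Since rank \<open>(U V\<^sup>T)\<close> is at most the number of nonzero columns of \<open>U\<close> and of \<open>V\<close>, the factorized
  objective at \<open>(U, V)\<close> dominates \<open>\<nu> f + rank\<close> at \<open>U V\<^sup>T\<close>, with equality exactly when \<open>U\<close> and \<open>V\<close>
  are balanced and both column counts equal the rank.  The bound is attained over every matrix
  \<open>X\<close> of rank at most \<open>\<kappa>\<close>: a truncated singular value decomposition \<open>X = P \<Sigma> Q\<^sup>T\<close> yields the
  balanced factors \<open>P \<Sigma>\<^bsup>1/2\<^esup>\<close> and \<open>Q \<Sigma>\<^bsup>1/2\<^esup>\<close>.
\<close>

text \<open>Pairing with \<open>x\<close> turns the left side into the squared norm of
  \<open>A *v x\<close>. Applied twice below, to a matrix and to its transpose, it strips the outer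
  factors of a triple product.\<close>

lemma transpose_mult_self_eq_0_iff:
  fixes A :: "real ^ 'n ^ 'm"
  shows "transpose A *v (A *v x) = 0 \<longleftrightarrow> A *v x = 0"
proof
  assume "transpose A *v (A *v x) = 0"
  then have "(A *v x) \<bullet> (A *v x) = 0"
    by (metis dot_lmul_matrix inner_zero_left transpose_matrix_vector)
  then show "A *v x = 0" by simp
qed simp

lemma rank_le_norm_2_0:
  fixes A :: "real ^ 'n ^ 'm"
  shows "rank A \<le> norm_2_0 A"
proof -
  have "columns A \<subseteq> insert 0 ((\<lambda>j. column j A) ` {j. column j A \<noteq> 0})"
    by (auto simp: columns_def)
  then have "rank A \<le> dim ((\<lambda>j. column j A) ` {j. column j A \<noteq> 0})"
    unfolding column_rank_def by (metis dim_insert dim_subset span_zero)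
  also have "\<dots> \<le> card ((\<lambda>j. column j A) ` {j. column j A \<noteq> 0})"
    by (simp add: dim_le_card')
  also have "\<dots> \<le> norm_2_0 A"
    unfolding norm_2_0_def by (simp add: card_image_le)
  finally show ?thesis .
qed

lemma rank_mult_transpose_le_norm_2_0:
  fixes U :: "real ^ 'k ^ 'm" and V :: "real ^ 'k ^ 'n"
  shows "rank (U ** transpose V) \<le> norm_2_0 U" "rank (U ** transpose V) \<le> norm_2_0 V"
    "rank (U ** transpose V) \<le> CARD('k)"
  using rank_mul_le_left[of U "transpose V"] rank_mul_le_right[of U "transpose V"]
    rank_le_norm_2_0[of U] rank_le_norm_2_0[of V] rank_bound[of U]
  by (simp_all add: rank_transpose)

text \<open>Take \<open>v\<close> maximizing the norm of \<open>X *v v\<close> on the unit sphere,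
  \<sigma> the maximum and \<open>u\<close> the normalized image. The relation for
  \<open>transpose X\<close> then comes from equality in Cauchy-Schwarz, with no eigenvalue
  theory.\<close>

lemma top_singular_triple:
  fixes X :: "real ^ 'n ^ 'm"
  assumes "X \<noteq> 0"
  obtains \<sigma> u v where "\<sigma> > 0" "norm u = 1" "norm v = 1" "X *v v = \<sigma> *\<^sub>R u" "transpose X *v u = \<sigma> *\<^sub>R v"
proof -
  have "sphere (0::real^'n) 1 \<noteq> {}" by simp
  moreover have "continuous_on (sphere 0 1) (\<lambda>v. norm (X *v v))"
    by (intro continuous_intros)
  ultimately obtain v where v: "v \<in> sphere 0 1"
    and max: "\<And>w. w \<in> sphere 0 1 \<Longrightarrow> norm (X *v w) \<le> norm (X *v v)"
    using continuous_attains_sup[OF compact_sphere] by blast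
  define \<sigma> where "\<sigma> = norm (X *v v)"
  have bound: "norm (X *v w) \<le> \<sigma> * norm w" for w
  proof (cases "w = 0")
    case False
    then have "norm (X *v (w /\<^sub>R norm w)) \<le> \<sigma>"
      unfolding \<sigma>_def by (intro max) simp
    with False show ?thesis
      by (simp add: matrix_vector_mult_scaleR field_simps)
  qed simp
  have "\<sigma> > 0"
  proof (rule ccontr)
    assume "\<not> \<sigma> > 0"
    then have "\<sigma> = 0" unfolding \<sigma>_def by simp
    with bound have "\<And>w. X *v w = 0" by simp
    then have "X = 0" by (simp add: matrix_eq)
    with assms show False ..
  qed
  define u where "u = (X *v v) /\<^sub>R \<sigma>"
  have nu: "norm u = 1" and nv: "norm v = 1" and Xv: "X *v v = \<sigma> *\<^sub>R u"
    using \<open>\<sigma> > 0\<close> v by (auto simp: u_def \<sigma>_def)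
  define w where "w = transpose X *v u"
  have adj: "w \<bullet> y = u \<bullet> (X *v y)" for y
    by (simp add: w_def dot_lmul_matrix transpose_matrix_vector)
  \<comment> \<open>The operator bound for \<open>X\<close> passes to its adjoint: the squared norm
    of \<open>w\<close> is \<open>u \<bullet> (X *v w)\<close>, hence at most \<sigma> times the
    norm of \<open>w\<close>.\<close>
  have "(norm w)\<^sup>2 \<le> norm u * norm (X *v w)"
    by (metis adj norm_cauchy_schwarz power2_norm_eq_inner)
  also have "\<dots> \<le> \<sigma> * norm w" using bound nu by simp
  finally have "norm w \<le> \<sigma>"
    using \<open>\<sigma> > 0\<close> by (cases "w = 0") (auto simp: power2_eq_square)
  then have w2: "w \<bullet> w \<le> \<sigma>\<^sup>2"
    by (metis norm_ge_zero power2_norm_eq_inner power_mono)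
  have "w \<bullet> v = \<sigma>"
    using nu by (simp add: adj Xv dot_square_norm)
  \<comment> \<open>equality case of Cauchy--Schwarz\<close>
  moreover have "(w - \<sigma> *\<^sub>R v) \<bullet> (w - \<sigma> *\<^sub>R v) = w \<bullet> w - 2 * \<sigma> * (w \<bullet> v) + \<sigma>\<^sup>2 * (v \<bullet> v)"
    by (simp add: inner_diff_left inner_diff_right inner_commute power2_eq_square algebra_simps)
  moreover have "v \<bullet> v = 1" using nv by (simp add: norm_eq_1)
  ultimately have "(w - \<sigma> *\<^sub>R v) \<bullet> (w - \<sigma> *\<^sub>R v) \<le> 0"
    using w2 by (simp add: power2_eq_square)
  then have "w = \<sigma> *\<^sub>R v"
    by (metis inner_eq_zero_iff inner_ge_zero order_antisym right_minus_eq)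
  with that[OF \<open>\<sigma> > 0\<close> nu nv Xv] w_def show ?thesis by simp
qed

text \<open>Induction on \<open>S\<close> by deflation: subtracting the leading singular term lowers
  the rank, the remainder is factored on the smaller set, and the freed column stores the singular
  pair. The support condition keeps that column vacant and later bounds the number of nonzero
  columns.\<close>

lemma balanced_factorization:
  fixes X :: "real ^ 'n ^ 'm" and S :: "'k::finite set"
  assumes "rank X \<le> card S"
  shows "\<exists>(U :: real ^ 'k ^ 'm) (V :: real ^ 'k ^ 'n). U ** transpose V = X
    \<and> transpose U ** U = transpose V ** V
    \<and> (\<forall>l. l \<notin> S \<longrightarrow> column l U = 0 \<and> column l V = 0)"
  using finite[of S] assms
proof (induction S arbitrary: X rule: finite_induct)
  case empty
  then have "X = 0" by (simp add: rank_eq_0)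
  then show ?case
    by (intro exI[of _ 0]) (simp add: matrix_matrix_mult_def transpose_def column_def vec_eq_iff)
next
  case (insert j S)
  show ?case
  proof (cases "X = 0")
    case True
    then show ?thesis
      by (intro exI[of _ 0]) (simp add: matrix_matrix_mult_def transpose_def column_def vec_eq_iff)
  next
    case False
    then obtain \<sigma> u v where \<sigma>: "\<sigma> > 0" and nu: "norm u = 1" and nv: "norm v = 1"
      and Xv: "X *v v = \<sigma> *\<^sub>R u" and Xu: "transpose X *v u = \<sigma> *\<^sub>R v"
      by (rule top_singular_triple)
    \<comment> \<open>The subtracted matrix is the rank-one term \<sigma> times \<open>u\<close>
      times the transpose of \<open>v\<close>.\<close>
    define Y where "Y = X - (\<chi> i l. \<sigma> * u $ i * v $ l)"
    have Yx: "Y *v x = X *v x - (\<sigma> * (v \<bullet> x)) *\<^sub>R u" for x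
      by (simp add: Y_def matrix_vector_mult_def vec_eq_iff inner_vec_def left_diff_distrib
          sum_subtractf sum_distrib_left sum_distrib_right algebra_simps)
    have Yv: "Y *v v = 0"
      using nv by (simp add: Yx Xv dot_square_norm)
    have Yu: "transpose Y *v u = 0"
    proof (rule vector_eq_ldot[THEN iffD1], intro allI)
      fix x
      have "x \<bullet> (transpose Y *v u) = (transpose Y *v u) \<bullet> x" by (rule inner_commute)
      also have "\<dots> = u \<bullet> (Y *v x)" by (simp add: dot_lmul_matrix transpose_matrix_vector)
      also have "\<dots> = (transpose X *v u) \<bullet> x - \<sigma> * (v \<bullet> x)"
        using nu by (simp add: Yx inner_diff_right dot_square_norm dot_lmul_matrix transpose_matrix_vector)
      also have "\<dots> = x \<bullet> 0" by (simp only: Xu) simp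
      finally show "x \<bullet> (transpose Y *v u) = x \<bullet> 0" .
    qed
    \<comment> \<open>\<open>Y\<close> is \<open>X\<close> after projecting out \<open>v\<close>,
      which gives the inclusion. It is strict because \<open>u\<close> lies in the range of
      \<open>X\<close> but is orthogonal to the range of \<open>Y\<close>.\<close>
    have "range ((*v) Y) \<subset> range ((*v) X)"
    proof
      have "Y *v x = X *v (x - (v \<bullet> x) *\<^sub>R v)" for x
        by (simp add: Yx matrix_vector_mult_diff_distrib matrix_vector_mult_scaleR Xv)
      then show "range ((*v) Y) \<subseteq> range ((*v) X)" by auto
      have "u \<bullet> (Y *v x) = 0" for x
        by (metis Yu dot_lmul_matrix inner_zero_left transpose_matrix_vector)
      then have "u \<notin> range ((*v) Y)"
        using nu by (metis image_iff inner_eq_zero_iff norm_zero zero_neq_one)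
      moreover have "u = X *v (v /\<^sub>R \<sigma>)"
        using \<sigma> by (simp add: matrix_vector_mult_scaleR Xv)
      ultimately show "range ((*v) Y) \<noteq> range ((*v) X)" by blast
    qed
    then have "rank Y < rank X"
      unfolding rank_dim_range
      by (intro dim_psubset) (metis span_eq_iff linear_subspace_image matrix_vector_mul_linear subspace_UNIV)
    with insert have "rank Y \<le> card S" by simp
    then obtain U :: "real ^ 'k ^ 'm" and V :: "real ^ 'k ^ 'n"
      where UV: "U ** transpose V = Y" and bal: "transpose U ** U = transpose V ** V"
        and supp: "\<And>l. l \<notin> S \<Longrightarrow> column l U = 0 \<and> column l V = 0"
      using insert.IH by blast
    \<comment> \<open>\<open>0 = V\<^sup>T Y\<^sup>T u = V\<^sup>T V U\<^sup>T u\<close>, which balance turns into \<open>U\<^sup>T U U\<^sup>T u = 0\<close>\<close>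
    have Uu: "transpose U *v u = 0"
    proof -
      have "transpose V *v (V *v (transpose U *v u)) = transpose V *v (transpose Y *v u)"
        by (simp add: UV[symmetric] matrix_transpose_mul matrix_vector_mul_assoc matrix_mul_assoc
            del: transpose_matrix_vector)
      then have "transpose U *v (U *v (transpose U *v u)) = 0"
        by (simp add: Yu matrix_vector_mul_assoc matrix_mul_assoc bal del: transpose_matrix_vector)
      then show ?thesis
        by (metis transpose_mult_self_eq_0_iff transpose_transpose)
    qed
    \<comment> \<open>The mirror argument, starting from \<open>Y *v v = 0\<close> and using balance
      in the other direction.\<close>
    have Vv: "transpose V *v v = 0"
    proof -
      have "transpose U *v (U *v (transpose V *v v)) = transpose U *v (Y *v v)"
        by (simp add: UV[symmetric] matrix_vector_mul_assoc matrix_mul_assoc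
            del: transpose_matrix_vector)
      then have "transpose V *v (V *v (transpose V *v v)) = 0"
        by (simp add: Yv matrix_vector_mul_assoc matrix_mul_assoc bal del: transpose_matrix_vector)
      then show ?thesis
        by (metis transpose_mult_self_eq_0_iff transpose_transpose)
    qed
    \<comment> \<open>Splitting \<sigma> evenly as \<open>sqrt \<sigma>\<close> on both sides gives
      the two new columns the same norm.\<close>
    define U' where "U' = (\<chi> i l. if l = j then sqrt \<sigma> * u $ i else U $ i $ l)"
    define V' where "V' = (\<chi> i l. if l = j then sqrt \<sigma> * v $ i else V $ i $ l)"
    have "U' ** transpose V' = X"
    proof -
      \<comment> \<open>Since \<open>j\<close> is outside \<open>S\<close>, overwriting column
        \<open>j\<close> loses nothing from the product for \<open>Y\<close>.\<close>
      have 0: "U $ i $ j = 0" for i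
        using supp[of j] insert.hyps by (simp add: column_def vec_eq_iff)
      have "(U' ** transpose V') $ i $ l = X $ i $ l" for i l
      proof -
        have "(U' ** transpose V') $ i $ l = (\<Sum>k\<in>UNIV. U' $ i $ k * V' $ l $ k)"
          by (simp add: matrix_matrix_mult_def transpose_def)
        also have "\<dots> = \<sigma> * u $ i * v $ l + (\<Sum>k\<in>UNIV - {j}. U $ i $ k * V $ l $ k)"
          using \<sigma> by (subst sum.remove[of _ j]) (auto simp: U'_def V'_def intro!: sum.cong)
        also have "\<dots> = \<sigma> * u $ i * v $ l + (\<Sum>k\<in>UNIV. U $ i $ k * V $ l $ k)"
          by (subst (2) sum.remove[of _ j]) (auto simp: 0)
        also have "\<dots> = \<sigma> * u $ i * v $ l + Y $ i $ l"
          by (simp add: UV[symmetric] matrix_matrix_mult_def transpose_def)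
        also have "\<dots> = X $ i $ l" by (simp add: Y_def)
        finally show ?thesis .
      qed
      then show ?thesis by (simp add: vec_eq_iff)
    qed
    \<comment> \<open>In both Gram matrices the new diagonal entry is \<sigma> and the other entries
      of row and column \<open>j\<close> vanish by \<open>Uu\<close> and \<open>Vv\<close>; the
      remaining entries agree by balance of \<open>U\<close> and \<open>V\<close>.\<close>
    moreover have "transpose U' ** U' = transpose V' ** V'"
    proof -
      have colU: "column l U' = (if l = j then sqrt \<sigma> *\<^sub>R u else column l U)" for l
        by (simp add: U'_def column_def vec_eq_iff)
      have colV: "column l V' = (if l = j then sqrt \<sigma> *\<^sub>R v else column l V)" for l
        by (simp add: V'_def column_def vec_eq_iff)
      have gram: "(transpose A ** A) $ a $ b = column a A \<bullet> column b A"
        for a b and A :: "real ^ 'k ^ 'p"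
        by (simp add: matrix_matrix_mult_def transpose_def column_def inner_vec_def)
      have "column l U \<bullet> u = 0" for l
        using Uu by (simp add: matrix_vector_mult_def transpose_def column_def inner_vec_def vec_eq_iff)
      moreover have "column l V \<bullet> v = 0" for l
        using Vv by (simp add: matrix_vector_mult_def transpose_def column_def inner_vec_def vec_eq_iff)
      moreover have "column a U \<bullet> column b U = column a V \<bullet> column b V" for a b
        using bal by (metis gram)
      ultimately show ?thesis
        using nu nv by (simp add: vec_eq_iff gram colU colV inner_commute dot_square_norm)
    qed
    moreover have "column l U' = 0 \<and> column l V' = 0" if "l \<notin> insert j S" for l
      using supp[of l] that by (simp add: U'_def V'_def column_def vec_eq_iff)
    ultimately show ?thesis by blast
  qed
qed

text \<open>With a support of exactly \<open>rank X\<close> columns, the support bounds both column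
  counts above by the rank, and the general rank bound gives the reverse inequality.\<close>

lemma balanced_rank_factorization:
  fixes X :: "real ^ 'n ^ 'm"
  assumes "rank X \<le> CARD('k::finite)"
  obtains U :: "real ^ 'k ^ 'm" and V :: "real ^ 'k ^ 'n"
  where "U ** transpose V = X" "transpose U ** U = transpose V ** V"
    "norm_2_0 U = rank X" "norm_2_0 V = rank X"
proof -
  obtain S :: "'k set" where S: "card S = rank X"
    using obtain_subset_with_card_n[OF assms] by blast
  then obtain U :: "real ^ 'k ^ 'm" and V :: "real ^ 'k ^ 'n"
    where UV: "U ** transpose V = X" "transpose U ** U = transpose V ** V"
      and supp: "\<And>l. l \<notin> S \<Longrightarrow> column l U = 0 \<and> column l V = 0"
    using balanced_factorization[of X S] by auto
  have "norm_2_0 U \<le> card S" "norm_2_0 V \<le> card S"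
    unfolding norm_2_0_def using supp by (auto intro!: card_mono)
  with S UV rank_mult_transpose_le_norm_2_0[of U V] that show ?thesis by simp
qed

theorem lemma3p2:
  fixes f :: "real ^ 'n ^ 'm \<Rightarrow> real" and \<nu> \<mu> :: real
    and Xopt :: "(real ^ 'n ^ 'm) set"
  assumes "CARD('m) \<le> CARD('n)"
    and "smooth f" and "\<And>X. f X \<ge> 0"
    and "\<nu> > 0" and "\<mu> > 0"
    and "Xopt = global_minimizers (\<lambda>X. \<nu> * f X + real (rank X))"
    and "Xopt \<noteq> {}"
    and "Xopt \<inter> Omega CARD('k) \<noteq> {}"
  shows "global_minimizers (\<lambda>(U :: real ^ 'k ^ 'm, V :: real ^ 'k ^ 'n).
           \<nu> * f (U ** transpose V)
           + \<mu> / 4 * (norm (transpose U ** U - transpose V ** V))\<^sup>2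
           + 1 / 2 * (real (norm_2_0 U) + real (norm_2_0 V)))
       = {(U, V). U ** transpose V \<in> Xopt \<inter> Omega CARD('k)
           \<and> transpose U ** U = transpose V ** V
           \<and> norm_2_0 U = norm_2_0 V
           \<and> norm_2_0 V = rank (U ** transpose V)}"
proof -
  define g where "g X = \<nu> * f X + real (rank X)" for X
  define \<Phi> where "\<Phi> = (\<lambda>(U :: real ^ 'k ^ 'm, V :: real ^ 'k ^ 'n).
           \<nu> * f (U ** transpose V)
           + \<mu> / 4 * (norm (transpose U ** U - transpose V ** V))\<^sup>2
           + 1 / 2 * (real (norm_2_0 U) + real (norm_2_0 V)))"
  have opt: "X \<in> Xopt \<longleftrightarrow> (\<forall>Y. g X \<le> g Y)" for X
    by (auto simp: assms(6) g_def global_minimizers_def is_arg_min_linorder)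
  obtain X\<^sub>0 where X\<^sub>0: "\<And>Y. g X\<^sub>0 \<le> g Y" and "rank X\<^sub>0 \<le> CARD('k)"
    using assms(8) opt by (auto simp: Omega_def)
  define p where "p U V = \<mu> / 4 * (norm (transpose U ** U - transpose V ** V))\<^sup>2"
    for U :: "real ^ 'k ^ 'm" and V :: "real ^ 'k ^ 'n"
  have p: "p U V \<ge> 0" "p U V = 0 \<longleftrightarrow> transpose U ** U = transpose V ** V" for U V
    using \<open>\<mu> > 0\<close> by (simp_all add: p_def)
  \<comment> \<open>The excess of \<Phi> over \<open>g\<close> is split into three nonnegative
    terms, so it vanishes exactly when each of them does.\<close>
  have \<Phi>: "\<Phi> (U, V) = g (U ** transpose V) + p U V
      + (real (norm_2_0 U) - real (rank (U ** transpose V))) / 2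
      + (real (norm_2_0 V) - real (rank (U ** transpose V))) / 2" for U V
    by (simp add: \<Phi>_def g_def p_def field_simps)
  have ge: "g (U ** transpose V) \<le> \<Phi> (U, V)" for U V
    using rank_mult_transpose_le_norm_2_0[of U V] p(1)[of U V] unfolding \<Phi> by simp
  have eq: "\<Phi> (U, V) = g (U ** transpose V) \<longleftrightarrow> transpose U ** U = transpose V ** V
      \<and> norm_2_0 U = rank (U ** transpose V) \<and> norm_2_0 V = rank (U ** transpose V)" for U V
  proof -
    have "real (rank (U ** transpose V)) \<le> real (norm_2_0 U)"
      and "real (rank (U ** transpose V)) \<le> real (norm_2_0 V)"
      using rank_mult_transpose_le_norm_2_0[of U V] by simp_all
    with p(1)[of U V] show ?thesis
      unfolding \<Phi> p(2)[symmetric] of_nat_eq_iff[where 'a = real, symmetric] by argo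
  qed
  obtain U\<^sub>0 V\<^sub>0 where "\<Phi> (U\<^sub>0, V\<^sub>0) = g X\<^sub>0"
    using balanced_rank_factorization[OF \<open>rank X\<^sub>0 \<le> CARD('k)\<close>] eq by metis
  \<comment> \<open>The value \<open>g X\<^sub>0\<close> bounds \<Phi> from below and is attained at
    the balanced factors of \<open>X\<^sub>0\<close>, so it is the minimum of \<Phi>.\<close>
  then have min: "(U, V) \<in> global_minimizers \<Phi> \<longleftrightarrow> \<Phi> (U, V) \<le> g X\<^sub>0" for U V
    using X\<^sub>0 ge unfolding global_minimizers_def is_arg_min_linorder
    by simp (metis order_trans)
  have "(U, V) \<in> global_minimizers \<Phi> \<longleftrightarrow> U ** transpose V \<in> Xopt \<inter> Omega CARD('k)
      \<and> transpose U ** U = transpose V ** V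
      \<and> norm_2_0 U = norm_2_0 V \<and> norm_2_0 V = rank (U ** transpose V)" for U V
  proof -
    \<comment> \<open>In the chain from \<open>g X\<^sub>0\<close> through
      \<open>g (U ** transpose V)\<close> to \<open>\<Phi> (U, V)\<close>, equality of the ends
      forces equality at both links.\<close>
    have "\<Phi> (U, V) \<le> g X\<^sub>0
        \<longleftrightarrow> U ** transpose V \<in> Xopt \<and> \<Phi> (U, V) = g (U ** transpose V)"
      using ge[of U V] X\<^sub>0 unfolding opt by (metis order_antisym order_trans)
    then show ?thesis
      \<comment> \<open>Membership in \<open>Omega\<close> is automatic, as the product factors
        through \<kappa> columns.\<close>
      using rank_mult_transpose_le_norm_2_0(3)[of U V] by (auto simp: min eq Omega_def)
  qed
  then show ?thesis unfolding \<Phi>_def by auto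
qed

end
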